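(* Let $\mathbb{H}$ be a connected bipartite graph with parts $A_H,B_H$ and let $\mathbb{K}$ be a connected bipartite graph with parts $A_K,B_K$. Suppose $\mathbb{H}$ and $\mathbb{K}$ admit polarities $\rho_H$ and $\rho_K$, with polarity quotient graphs $P_H(\mathbb{H})$ and $P_K(\mathbb{K})$ (self-loops retained). Let $P(\mathbb{H}\odot\mathbb{K})$ be the polarity quotient graph (self-loops retained) of the Reduced-Kronecker product $\mathbb{H}\odot\mathbb{K}$ with respect to the composed polarity $\rho=(\rho_H,\rho_K)$, $\rho((h,k))=(\rho_H(h),\rho_K(k))$. Then $P(\mathbb{H}\odot\mathbb{K})$ is isomorphic, as a graph with loops, to $P_H(\mathbb{H})\otimes P_K(\mathbb{K})$.
   Context: Graphs are undirected, without multi-edges; self-loops are allowed (bipartite graphs have none). Kronecker product: for graphs $H,K$, $H\otimes K$ has vertex set $V(H)\times V(K)$, and $((h_1,k_1),(h_2,k_2))$ is an edge if and only if $(h_1,h_2)\in E(H)$ and $(k_1,k_2)\in E(K)$ (so loops of the factors contribute edges). Polarity: for a bipartite graph $\mathbb{G}$ with parts $A,B$, a polarity is a graph automorphism $\rho$ of $\mathbb{G}$ that is an involution with $\rho(A)=B$ and $\rho(B)=A$. Polarity quotient: $P(\mathbb{G})$ is the graph whose vertices are the orbits $[v]=\{v,\rho(v)\}$, with $[v]$ and $[w]$ adjacent whenever there are $v'\in[v]$, $w'\in[w]$ with $(v',w')\in E(\mathbb{G})$. Multi-edges are merged into one edge, and self-loops (arising when $(v,\rho(v))\in E(\mathbb{G})$)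 are retained. Reduced-Kronecker product: for connected bipartite $\mathbb{H}$ and $\mathbb{K}$, $\mathbb{H}\otimes\mathbb{K}$ has exactly two components, with vertex sets $(A_H\times A_K)\cup(B_H\times B_K)$ and $(A_H\times B_K)\cup(B_H\times A_K)$. When at least one factor has a bipartition-reversing automorphism (in particular a polarity), these components are isomorphic, and $\mathbb{H}\odot\mathbb{K}$ denotes one of them. The map $\rho((h,k))=(\rho_H(h),\rho_K(k))$ on $\mathbb{H}\otimes\mathbb{K}$ restricts to a polarity of each component; it is called the composed polarity. *)

theory Defs
  imports "Graph_Theory.Digraph_Isomorphism"
begin

text \<open>
  An undirected graph without multi-edges, possibly with loops, is a symmetric digraph whose arcs
  are pairs of vertices, i.e. a \<open>'a pair_pre_digraph\<close> satisfying \<^locale>\<open>pair_sym_digraph\<close>. A loop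
  at \<open>v\<close> is the arc \<open>(v, v)\<close>. No finiteness is imposed.
  The map \<^const>\<open>with_proj\<close> embeds these graphs into the general digraphs of the library; on them
  \<^const>\<open>digraph_iso\<close> amounts to a bijection of the vertex sets that preserves and reflects
  adjacency, loops included.
\<close>

definition bipartition :: "'a pair_pre_digraph \<Rightarrow> 'a set \<Rightarrow> 'a set \<Rightarrow> bool" where
  "bipartition G A B \<longleftrightarrow>
     A \<union> B = pverts G \<and> A \<inter> B = {} \<and> parcs G \<subseteq> A \<times> B \<union> B \<times> A"

text \<open>Vertex maps are total functions on the ambient type; only their values on the vertex set
  matter here and below.\<close>

definition graph_automorphism :: "'a pair_pre_digraph \<Rightarrow> ('a \<Rightarrow> 'a) \<Rightarrow> bool" where
  "graph_automorphism G \<rho> \<longleftrightarrow>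
     bij_betw \<rho> (pverts G) (pverts G) \<and>
     (\<forall>u \<in> pverts G. \<forall>v \<in> pverts G. (u, v) \<in> parcs G \<longleftrightarrow> (\<rho> u, \<rho> v) \<in> parcs G)"

definition polarity ::
    "'a pair_pre_digraph \<Rightarrow> 'a set \<Rightarrow> 'a set \<Rightarrow> ('a \<Rightarrow> 'a) \<Rightarrow> bool" where
  "polarity G A B \<rho> \<longleftrightarrow>
     graph_automorphism G \<rho> \<and> (\<forall>v \<in> pverts G. \<rho> (\<rho> v) = v) \<and> \<rho> ` A = B \<and> \<rho> ` B = A"

definition orbits :: "'a pair_pre_digraph \<Rightarrow> ('a \<Rightarrow> 'a) \<Rightarrow> 'a set set" where
  "orbits G \<rho> = (\<lambda>v. {v, \<rho> v}) ` pverts G"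

text \<open>The two orbits \<open>X\<close> and \<open>Y\<close> may coincide, which yields the self-loops.\<close>

definition polarity_quotient ::
    "'a pair_pre_digraph \<Rightarrow> ('a \<Rightarrow> 'a) \<Rightarrow> 'a set pair_pre_digraph" where
  "polarity_quotient G \<rho> =
     \<lparr> pverts = orbits G \<rho>,
       parcs = {(X, Y). X \<in> orbits G \<rho> \<and> Y \<in> orbits G \<rho> \<and>
                        (\<exists>v \<in> X. \<exists>w \<in> Y. (v, w) \<in> parcs G)} \<rparr>"

definition kronecker_product ::
    "'a pair_pre_digraph \<Rightarrow> 'b pair_pre_digraph \<Rightarrow> ('a \<times> 'b) pair_pre_digraph" where
  "kronecker_product H K =
     \<lparr> pverts = pverts H \<times> pverts K,
       parcs = {((h1, k1), (h2, k2)) | h1 k1 h2 k2.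
                  (h1, h2) \<in> parcs H \<and> (k1, k2) \<in> parcs K} \<rparr>"

text \<open>
  The reduced Kronecker product of two connected bipartite graphs is either one of the (two)
  connected components of their Kronecker product. As the choice of component is left open, it is
  rendered as a predicate on \<open>R\<close>, satisfied by each component.
\<close>

definition reduced_kronecker_product ::
    "('a \<times> 'b) pair_pre_digraph \<Rightarrow> 'a pair_pre_digraph \<Rightarrow> 'b pair_pre_digraph \<Rightarrow> bool" where
  "reduced_kronecker_product R H K \<longleftrightarrow>
     pre_digraph.max_subgraph (with_proj (kronecker_product H K)) connected (with_proj R)"

definition composed_polarity :: "('a \<Rightarrow> 'a) \<Rightarrow> ('b \<Rightarrow> 'b) \<Rightarrow> 'a \<times> 'b \<Rightarrow> 'a \<times> 'b" where
  "composed_polarity \<rho>\<^sub>H \<rho>\<^sub>K = (\<lambda>(h, k). (\<rho>\<^sub>H h, \<rho>\<^sub>K k))"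

end

theory Submission
  imports Defs
begin

text \<open>
  Write \<open>V\<close> for vertex sets and call a pair \<open>(h, k)\<close> \<^emph>\<open>even\<close> if \<open>h \<in> A\<^sub>H\<close> and \<open>k \<in> A\<^sub>K\<close> are both true or
  both false, \<^emph>\<open>odd\<close> otherwise. An edge of the Kronecker product moves both coordinates to the other
  side of their bipartitions, so parity is constant on components; conversely two pairs of equal
  parity are connected, by walking in one coordinate while the other one bounces back and forth on
  a single edge (\<open>kronecker_reachable_iff\<close>). So the reduced product \<open>R\<close> is the subgraph induced
  on the pairs of one parity (\<open>reduced_kronecker_product_parity\<close>).

  Let \<open>h\<close> and \<open>k\<close> be vertices, with orbits \<open>[h]\<close> and \<open>[k]\<close>. A polarity changes sides, so among the
  four elements of \<open>[h] \<times> [k]\<close> exactly two have the parity of \<open>R\<close>, and these two form one orbit of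
  the composed polarity. Hence sending an orbit of the composed polarity to the pair of its
  projections is a bijection from the orbits in \<open>R\<close> to the pairs of orbits, its inverse being
  \<open>([h], [k]) \<mapsto> ([h] \<times> [k]) \<inter> V(R)\<close>.

  The map clearly preserves adjacency. For the converse, take edges \<open>a b\<close> of \<open>H\<close> and \<open>c d\<close> of \<open>K\<close>
  witnessing adjacency of the projections. If \<open>(a, c)\<close> has the wrong parity, replace the second
  edge by its image \<open>\<rho>\<^sub>K c \<rho>\<^sub>K d\<close>, which witnesses the same adjacency; afterwards \<open>(a, c)\<close> and
  \<open>(b, d)\<close> both lie in \<open>R\<close>, and the edge between them joins the two original orbits.
\<close>

section \<open>Isomorphisms and components\<close>

lemma digraph_iso_with_projI:
  assumes G: "pair_wf_digraph G" and H: "pair_wf_digraph H"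
    and f: "bij_betw f (pverts G) (pverts H)"
    and arcs: "\<And>u v. u \<in> pverts G \<Longrightarrow> v \<in> pverts G \<Longrightarrow>
                 (u, v) \<in> parcs G \<longleftrightarrow> (f u, f v) \<in> parcs H"
  shows "digraph_iso (with_proj G) (with_proj H)"
proof -
  interpret G: pair_wf_digraph G by fact
  interpret H: pair_wf_digraph H by fact
  let ?F = "\<lparr>iso_verts = f, iso_arcs = map_prod f f, iso_head = snd, iso_tail = fst\<rparr>"
  have inj: "inj_on f (pverts G)" and surj: "f ` pverts G = pverts H"
    using f by (auto simp: bij_betw_def)
  have "parcs G \<subseteq> pverts G \<times> pverts G"
    using G.wellformed' by auto
  then have "inj_on (map_prod f f) (parcs G)"
    by (intro inj_on_subset[OF map_prod_inj_on[OF inj inj]])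
  then have iso: "pre_digraph.digraph_isomorphism (with_proj G) ?F"
    using inj G.wf_digraph by (auto simp: pre_digraph.digraph_isomorphism_def)
  have "parcs H = map_prod f f ` parcs G"
  proof (intro set_eqI iffI)
    fix e assume e: "e \<in> parcs H"
    obtain x y where [simp]: "e = (x, y)" by (cases e)
    have "x \<in> f ` pverts G" "y \<in> f ` pverts G"
      using e H.wellformed' surj by auto
    then obtain u v where uv: "u \<in> pverts G" "v \<in> pverts G" "x = f u" "y = f v"
      by blast
    then have "(u, v) \<in> parcs G"
      using e arcs by auto
    with uv show "e \<in> map_prod f f ` parcs G"
      by (auto intro: rev_image_eqI)
  next
    fix e assume "e \<in> map_prod f f ` parcs G"
    then obtain u v where uv: "(u, v) \<in> parcs G" "e = (f u, f v)"
      by auto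
    then show "e \<in> parcs H"
      using arcs[OF G.wellformed'[OF uv(1)]] by simp
  qed
  then have "with_proj H = app_iso ?F (with_proj G)"
    using surj by (simp add: app_iso_def with_proj_def)
  with iso show ?thesis
    unfolding digraph_iso_def by blast
qed

text \<open>
  The subgraph induced on the vertices reachable from \<open>u\<close> is itself connected and contains every
  connected subgraph through \<open>u\<close>, so a maximal one cannot be smaller.
\<close>

lemma (in sym_digraph) max_connected_subgraph_eq_induce_reachable:
  assumes R: "max_subgraph connected R" and u: "u \<in> verts R"
  shows "R = G \<restriction> {v. u \<rightarrow>\<^sup>* v}"
proof -
  let ?C = "{v. u \<rightarrow>\<^sup>* v}"
  have sub: "subgraph R G" and conn: "connected R"
    using R by (auto simp: max_subgraph_def)
  have uG: "u \<in> verts G"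
    using sub u by auto
  have "v \<in> ?C" if v: "v \<in> verts R" for v
  proof -
    have "u \<rightarrow>\<^sup>*\<^bsub>mk_symmetric R\<^esub> v"
      using conn u v by (auto simp: connected_def strongly_connected_def)
    then have "u \<rightarrow>\<^sup>*\<^bsub>mk_symmetric G\<^esub> v"
      using subgraph_mk_symmetric[OF sub] by (rule pre_digraph.reachable_mono)
    then show ?thesis
      using sym_arcs by (simp add: reachable_mk_symmetric_eq)
  qed
  then have verts: "verts R \<subseteq> ?C" by blast
  have C: "subgraph (G \<restriction> ?C) G"
    using induce_reachable_is_in_sccs[OF uG] by (auto simp: sccs_def)
  interpret R: wf_digraph R using sub by auto
  have "tail R a \<in> ?C" "head R a \<in> ?C" if "a \<in> arcs R" for a
    using that verts R.wellformed by blast+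
  then have "subgraph R (G \<restriction> ?C)"
    using sub C verts by (auto simp: subgraph_def compatible_def)
  moreover have "connected (G \<restriction> ?C)"
  proof -
    interpret C: wf_digraph "G \<restriction> ?C" using C by auto
    have "strongly_connected (G \<restriction> ?C)"
      using induce_reachable_is_in_sccs[OF uG] by (auto simp: sccs_def)
    moreover have "symmetric (G \<restriction> ?C)"
      using induce_reachable_is_in_sccs[OF uG] sym_arcs
      by (auto simp: sccs_def intro: induced_graph_imp_symmetric)
    ultimately show ?thesis
      by (simp add: connected_def strongly_connected_def C.reachable_mk_symmetric_eq)
  qed
  ultimately show ?thesis
    using R C unfolding max_subgraph_def by metis
qed

lemma neighbour_of_strongly_connected:
  assumes "strongly_connected (with_proj G)" "u \<in> pverts G" "v \<in> pverts G" "u \<noteq> v"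
  obtains w where "(u, w) \<in> parcs G"
proof -
  have "u \<rightarrow>\<^sup>*\<^bsub>with_proj G\<^esub> v"
    using assms by (auto simp: strongly_connected_def)
  then show thesis
    using assms(4) that by (cases rule: pre_digraph.converse_reachable_cases) auto
qed

section \<open>Components of the Kronecker product\<close>

lemma pverts_kronecker_product [simp]:
  "pverts (kronecker_product H K) = pverts H \<times> pverts K"
  by (simp add: kronecker_product_def)

lemma parcs_kronecker_product [simp]:
  "((h, k), (h', k')) \<in> parcs (kronecker_product H K) \<longleftrightarrow>
     (h, h') \<in> parcs H \<and> (k, k') \<in> parcs K"
  by (simp add: kronecker_product_def)

lemma pair_wf_digraph_kronecker_product:
  assumes "pair_wf_digraph H" "pair_wf_digraph K"
  shows "pair_wf_digraph (kronecker_product H K)"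
proof -
  interpret H: pair_wf_digraph H by fact
  interpret K: pair_wf_digraph K by fact
  show ?thesis
    by unfold_locales (auto simp: kronecker_product_def dest: H.wellformed' K.wellformed')
qed

lemma pair_sym_digraph_kronecker_product:
  assumes "pair_sym_digraph H" "pair_sym_digraph K"
  shows "pair_sym_digraph (kronecker_product H K)"
proof -
  interpret H: pair_sym_digraph H by fact
  interpret K: pair_sym_digraph K by fact
  interpret P: pair_wf_digraph "kronecker_product H K"
    by (rule pair_wf_digraph_kronecker_product) unfold_locales
  show ?thesis
    by unfold_locales
      (auto simp: symmetric_def sym_def dest: H.arcs_symmetric K.arcs_symmetric)
qed

text \<open>
  A walk in one factor lifts to the product by letting the other coordinate alternate between the
  two ends of an edge; where it stops depends on the parity of the length of the walk. The two
  versions are mirror images.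
\<close>

lemma kronecker_reachable_bounce_snd:
  assumes "pair_sym_digraph H" "pair_sym_digraph K"
    and "h \<rightarrow>\<^sup>*\<^bsub>with_proj H\<^esub> h'" and k: "(k, l) \<in> parcs K"
  shows "\<exists>m \<in> {k, l}. (h, k) \<rightarrow>\<^sup>*\<^bsub>with_proj (kronecker_product H K)\<^esub> (h', m)"
proof -
  interpret H: pair_sym_digraph H by fact
  interpret K: pair_sym_digraph K by fact
  interpret P: pair_sym_digraph "kronecker_product H K"
    using assms by (intro pair_sym_digraph_kronecker_product)
  from assms(3) show ?thesis
  proof (induction rule: H.reachable_induct)
    case base
    then show ?case
      using k K.wellformed' by (intro bexI[of _ k]) auto
  next
    case (step x y)
    then obtain m m' where m: "m' \<in> {k, l}" "(m, m') \<in> parcs K"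
        "(h, k) \<rightarrow>\<^sup>*\<^bsub>with_proj (kronecker_product H K)\<^esub> (x, m)"
      using k K.arcs_symmetric[OF k] by blast
    then have "(h, k) \<rightarrow>\<^sup>*\<^bsub>with_proj (kronecker_product H K)\<^esub> (y, m')"
      using step.hyps by (intro P.reachable_adj_trans[OF m(3)]) simp
    with m(1) show ?case by blast
  qed
qed

lemma kronecker_reachable_bounce_fst:
  assumes "pair_sym_digraph H" "pair_sym_digraph K"
    and "k \<rightarrow>\<^sup>*\<^bsub>with_proj K\<^esub> k'" and h: "(h, g) \<in> parcs H"
  shows "\<exists>m \<in> {h, g}. (h, k) \<rightarrow>\<^sup>*\<^bsub>with_proj (kronecker_product H K)\<^esub> (m, k')"
proof -
  interpret H: pair_sym_digraph H by fact
  interpret K: pair_sym_digraph K by fact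
  interpret P: pair_sym_digraph "kronecker_product H K"
    using assms by (intro pair_sym_digraph_kronecker_product)
  from assms(3) show ?thesis
  proof (induction rule: K.reachable_induct)
    case base
    then show ?case
      using h H.wellformed' by (intro bexI[of _ h]) auto
  next
    case (step x y)
    then obtain m m' where m: "m' \<in> {h, g}" "(m, m') \<in> parcs H"
        "(h, k) \<rightarrow>\<^sup>*\<^bsub>with_proj (kronecker_product H K)\<^esub> (m, x)"
      using h H.arcs_symmetric[OF h] by blast
    then have "(h, k) \<rightarrow>\<^sup>*\<^bsub>with_proj (kronecker_product H K)\<^esub> (m', y)"
      using step.hyps by (intro P.reachable_adj_trans[OF m(3)]) simp
    with m(1) show ?case by blast
  qed
qed

lemma bipartition_arc_changes_side:
  assumes "bipartition G A B" "(u, v) \<in> parcs G"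
  shows "v \<in> A \<longleftrightarrow> u \<notin> A"
  using assms by (auto simp: bipartition_def)

text \<open>
  Parity is invariant because an edge flips both memberships. Given equal parity, bouncing twice
  reaches \<open>(h', k')\<close> or \<open>(g, k')\<close> with \<open>g\<close> a neighbour of \<open>h'\<close>; the latter has the wrong parity.
  The assumption that every vertex has a neighbour supplies the edges to bounce on: if \<open>K\<close> were a
  single vertex, the product would have no edges at all.
\<close>

lemma kronecker_reachable_iff:
  assumes sym: "pair_sym_digraph H" "pair_sym_digraph K"
    and sc: "strongly_connected (with_proj H)" "strongly_connected (with_proj K)"
    and bip: "bipartition H A B" "bipartition K C D"
    and nbr: "\<And>h. h \<in> pverts H \<Longrightarrow> \<exists>g. (h, g) \<in> parcs H"
             "\<And>k. k \<in> pverts K \<Longrightarrow> \<exists>l. (k, l) \<in> parcs K"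
    and hk: "h \<in> pverts H" "k \<in> pverts K"
  shows "(h, k) \<rightarrow>\<^sup>*\<^bsub>with_proj (kronecker_product H K)\<^esub> (h', k') \<longleftrightarrow>
    h' \<in> pverts H \<and> k' \<in> pverts K \<and> ((h' \<in> A \<longleftrightarrow> k' \<in> C) \<longleftrightarrow> (h \<in> A \<longleftrightarrow> k \<in> C))"
    (is "?reach (h, k) (h', k') \<longleftrightarrow> ?same h' k'")
proof -
  interpret P: pair_sym_digraph "kronecker_product H K"
    using sym by (intro pair_sym_digraph_kronecker_product)
  have invariant: "(fst y \<in> A \<longleftrightarrow> snd y \<in> C) \<longleftrightarrow> (fst x \<in> A \<longleftrightarrow> snd x \<in> C)" if "?reach x y" for x y
    using that
  proof (induction rule: P.reachable_induct)
    case (step v w)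
    then show ?case
      using bip[THEN bipartition_arc_changes_side]
      by (cases v; cases w) auto
  qed simp
  show ?thesis
  proof
    assume "?reach (h, k) (h', k')"
    then show "?same h' k'"
      using invariant P.reachable_in_verts by fastforce
  next
    assume same: "?same h' k'"
    obtain l where l: "(k, l) \<in> parcs K" using nbr hk by blast
    obtain g where g: "(h', g) \<in> parcs H" using nbr same by blast
    have "h \<rightarrow>\<^sup>*\<^bsub>with_proj H\<^esub> h'"
      using sc hk same by (auto simp: strongly_connected_def)
    then obtain m where m: "?reach (h, k) (h', m)"
      using kronecker_reachable_bounce_snd[OF sym _ l] by blast
    then have "m \<in> pverts K"
      using P.reachable_in_verts by fastforce
    then have "m \<rightarrow>\<^sup>*\<^bsub>with_proj K\<^esub> k'"
      using sc same by (auto simp: strongly_connected_def)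
    then obtain n where n: "n \<in> {h', g}" "?reach (h', m) (n, k')"
      using kronecker_reachable_bounce_fst[OF sym _ g] by blast
    have reach: "?reach (h, k) (n, k')"
      using m n(2) by (rule P.reachable_trans)
    then have "n \<in> A \<longleftrightarrow> h' \<in> A"
      using invariant[OF reach] same by auto
    then have "n = h'"
      using n(1) bipartition_arc_changes_side[OF bip(1) g] by auto
    with reach show "?reach (h, k) (h', k')" by simp
  qed
qed

lemma reduced_kronecker_product_parity:
  assumes sym: "pair_sym_digraph H" "pair_sym_digraph K"
    and sc: "strongly_connected (with_proj H)" "strongly_connected (with_proj K)"
    and bip: "bipartition H A B" "bipartition K C D"
    and nbr: "\<And>h. h \<in> pverts H \<Longrightarrow> \<exists>g. (h, g) \<in> parcs H"
             "\<And>k. k \<in> pverts K \<Longrightarrow> \<exists>l. (k, l) \<in> parcs K"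
    and R: "reduced_kronecker_product R H K"
  obtains p where
    "\<And>h k. (h, k) \<in> pverts R \<longleftrightarrow>
       h \<in> pverts H \<and> k \<in> pverts K \<and> ((h \<in> A \<longleftrightarrow> k \<in> C) \<longleftrightarrow> p)"
    "\<And>x y. (x, y) \<in> parcs R \<longleftrightarrow>
       x \<in> pverts R \<and> y \<in> pverts R \<and> (x, y) \<in> parcs (kronecker_product H K)"
proof -
  let ?P = "kronecker_product H K"
  interpret P: pair_sym_digraph ?P
    using sym by (intro pair_sym_digraph_kronecker_product)
  have max: "P.max_subgraph connected (with_proj R)"
    using R by (simp add: reduced_kronecker_product_def)
  then have sub: "subgraph (with_proj R) (with_proj ?P)" and "connected (with_proj R)"
    by (auto simp: P.max_subgraph_def)
  then obtain h k where hk: "(h, k) \<in> pverts R"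
    by (auto simp: connected_def strongly_connected_def)
  then have hk': "h \<in> pverts H" "k \<in> pverts K"
    using subgraph_imp_subverts[OF sub] by auto
  define S where "S = {v. (h, k) \<rightarrow>\<^sup>*\<^bsub>with_proj ?P\<^esub> v}"
  have eq: "with_proj R = with_proj ?P \<restriction> S"
    using P.max_connected_subgraph_eq_induce_reachable[OF max] hk by (simp add: S_def)
  have V: "pverts R = S"
    using arg_cong[OF eq, of verts] by simp
  have E: "parcs R = {e \<in> parcs ?P. fst e \<in> S \<and> snd e \<in> S}"
    using arg_cong[OF eq, of arcs] by (simp add: induce_subgraph_def)
  show thesis
  proof (rule that[of "h \<in> A \<longleftrightarrow> k \<in> C"])
    show "(x, y) \<in> pverts R \<longleftrightarrow>
      x \<in> pverts H \<and> y \<in> pverts K \<and> ((x \<in> A \<longleftrightarrow> y \<in> C) \<longleftrightarrow> (h \<in> A \<longleftrightarrow> k \<in> C))" for x y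
      unfolding V S_def using kronecker_reachable_iff[OF sym sc bip nbr hk'] by simp
  qed (auto simp: E V)
qed

section \<open>Polarities and their quotients\<close>

lemma polarity_closed:
  assumes "polarity G A B \<rho>" "v \<in> pverts G"
  shows "\<rho> v \<in> pverts G"
  using assms by (auto simp: polarity_def graph_automorphism_def bij_betw_def)

lemma polarity_changes_side:
  assumes "bipartition G A B" "polarity G A B \<rho>" "v \<in> pverts G"
  shows "\<rho> v \<in> A \<longleftrightarrow> v \<notin> A"
proof -
  have "v \<in> A \<union> B" "A \<inter> B = {}" "\<rho> ` A = B" "\<rho> ` B = A"
    using assms by (auto simp: polarity_def bipartition_def)
  then show ?thesis by blast
qed

lemma polarity_arc:
  assumes "pair_wf_digraph G" "polarity G A B \<rho>" "(u, v) \<in> parcs G"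
  shows "(\<rho> u, \<rho> v) \<in> parcs G"
  using assms(2,3) pair_wf_digraph.wellformed'[OF assms(1,3)]
  by (simp add: polarity_def graph_automorphism_def)

lemma polarity_involution:
  assumes "polarity G A B \<rho>" "v \<in> pverts G"
  shows "\<rho> (\<rho> v) = v"
  using assms by (auto simp: polarity_def)

lemma pverts_polarity_quotient [simp]: "pverts (polarity_quotient G \<rho>) = orbits G \<rho>"
  by (simp add: polarity_quotient_def)

lemma parcs_polarity_quotient:
  "(X, Y) \<in> parcs (polarity_quotient G \<rho>) \<longleftrightarrow>
     X \<in> orbits G \<rho> \<and> Y \<in> orbits G \<rho> \<and> (\<exists>v \<in> X. \<exists>w \<in> Y. (v, w) \<in> parcs G)"
  by (simp add: polarity_quotient_def)

lemma pair_wf_digraph_polarity_quotient: "pair_wf_digraph (polarity_quotient G \<rho>)"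
  by unfold_locales (auto simp: polarity_quotient_def)

lemma polarity_vertex_has_neighbour:
  assumes "strongly_connected (with_proj G)" "bipartition G A B" "polarity G A B \<rho>" "v \<in> pverts G"
  shows "\<exists>w. (v, w) \<in> parcs G"
proof -
  \<comment> \<open>\<open>v\<close> and \<open>\<rho> v\<close> lie on different sides, so there is a second vertex to walk to.\<close>
  have "v \<noteq> \<rho> v"
    using polarity_changes_side[OF assms(2-4)] by auto
  then show ?thesis
    using neighbour_of_strongly_connected[OF assms(1,4) polarity_closed[OF assms(3,4)]] by blast
qed

section \<open>The quotient of the reduced Kronecker product\<close>

theorem theorem1p1:
  fixes H :: "'a pair_pre_digraph" and K :: "'b pair_pre_digraph"
    and A\<^sub>H B\<^sub>H :: "'a set" and A\<^sub>K B\<^sub>K :: "'b set"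
    and \<rho>\<^sub>H :: "'a \<Rightarrow> 'a" and \<rho>\<^sub>K :: "'b \<Rightarrow> 'b"
    and R :: "('a \<times> 'b) pair_pre_digraph"
  assumes "pair_sym_digraph H" and "connected (with_proj H)" and "bipartition H A\<^sub>H B\<^sub>H"
    and "pair_sym_digraph K" and "connected (with_proj K)" and "bipartition K A\<^sub>K B\<^sub>K"
    and "polarity H A\<^sub>H B\<^sub>H \<rho>\<^sub>H" and "polarity K A\<^sub>K B\<^sub>K \<rho>\<^sub>K"
    and "reduced_kronecker_product R H K"
  shows "digraph_iso
           (with_proj (polarity_quotient R (composed_polarity \<rho>\<^sub>H \<rho>\<^sub>K)))
           (with_proj (kronecker_product (polarity_quotient H \<rho>\<^sub>H) (polarity_quotient K \<rho>\<^sub>K)))"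
proof -
  interpret H: pair_sym_digraph H by fact
  interpret K: pair_sym_digraph K by fact
  note bipH = assms(3) and bipK = assms(6) and polH = assms(7) and polK = assms(8)
  have scH: "strongly_connected (with_proj H)"
    using H.symmetric_connected_imp_strongly_connected H.sym_arcs assms(2) by blast
  have scK: "strongly_connected (with_proj K)"
    using K.symmetric_connected_imp_strongly_connected K.sym_arcs assms(5) by blast
  obtain p where
    V: "\<And>h k. (h, k) \<in> pverts R \<longleftrightarrow>
          h \<in> pverts H \<and> k \<in> pverts K \<and> ((h \<in> A\<^sub>H \<longleftrightarrow> k \<in> A\<^sub>K) \<longleftrightarrow> p)" and
    E: "\<And>x y. (x, y) \<in> parcs R \<longleftrightarrow>
          x \<in> pverts R \<and> y \<in> pverts R \<and> (x, y) \<in> parcs (kronecker_product H K)"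
    using reduced_kronecker_product_parity[OF assms(1,4) scH scK bipH bipK
        polarity_vertex_has_neighbour[OF scH bipH polH]
        polarity_vertex_has_neighbour[OF scK bipK polK] assms(9)] by blast
  note sideH = polarity_changes_side[OF bipH polH] and sideK = polarity_changes_side[OF bipK polK]
    and closedH = polarity_closed[OF polH] and closedK = polarity_closed[OF polK]
  let ?\<rho> = "composed_polarity \<rho>\<^sub>H \<rho>\<^sub>K"
  let ?Q = "polarity_quotient R ?\<rho>"
  let ?T = "kronecker_product (polarity_quotient H \<rho>\<^sub>H) (polarity_quotient K \<rho>\<^sub>K)"
  define f :: "('a \<times> 'b) set \<Rightarrow> 'a set \<times> 'b set" where "f X = (fst ` X, snd ` X)" for X

  have f_orbit: "f {(h, k), ?\<rho> (h, k)} = ({h, \<rho>\<^sub>H h}, {k, \<rho>\<^sub>K k})" for h k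
    by (simp add: f_def composed_polarity_def)
  have orbit_eq: "{(h, k), ?\<rho> (h, k)} = ({h, \<rho>\<^sub>H h} \<times> {k, \<rho>\<^sub>K k}) \<inter> pverts R"
    if "(h, k) \<in> pverts R" for h k
    using that sideH[of h] sideK[of k] closedH[of h] closedK[of k]
    by (auto simp: V composed_polarity_def)
  have recover: "X = (fst (f X) \<times> snd (f X)) \<inter> pverts R" if X: "X \<in> orbits R ?\<rho>" for X
  proof -
    obtain x where "X = {x, ?\<rho> x}" "x \<in> pverts R"
      using X by (auto simp: orbits_def)
    then obtain h k where hk: "X = {(h, k), ?\<rho> (h, k)}" "(h, k) \<in> pverts R"
      by (cases x) blast
    show ?thesis
      unfolding hk(1) f_orbit fst_conv snd_conv by (rule orbit_eq[OF hk(2)])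
  qed
  have maps: "f X \<in> orbits H \<rho>\<^sub>H \<times> orbits K \<rho>\<^sub>K" if "X \<in> orbits R ?\<rho>" for X
    using that by (auto simp: orbits_def f_orbit V)

  have "inj_on f (orbits R ?\<rho>)"
    by (rule inj_on_inverseI[where g = "\<lambda>Z. (fst Z \<times> snd Z) \<inter> pverts R"])
      (rule recover[symmetric])
  moreover have "f ` orbits R ?\<rho> = orbits H \<rho>\<^sub>H \<times> orbits K \<rho>\<^sub>K"
  proof (intro equalityI subsetI)
    fix Z assume "Z \<in> orbits H \<rho>\<^sub>H \<times> orbits K \<rho>\<^sub>K"
    then obtain h k where hk: "h \<in> pverts H" "k \<in> pverts K" "Z = ({h, \<rho>\<^sub>H h}, {k, \<rho>\<^sub>K k})"
      by (auto simp: orbits_def)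
    \<comment> \<open>Both \<open>k\<close> and \<open>\<rho>\<^sub>K k\<close> represent the second orbit; one of them gives the parity of \<open>R\<close>.\<close>
    have "\<exists>l \<in> {k, \<rho>\<^sub>K k}. (h, l) \<in> pverts R"
      using hk sideK[of k] closedK[of k] by (auto simp: V)
    then obtain l where l: "l \<in> {k, \<rho>\<^sub>K k}" "(h, l) \<in> pverts R" by blast
    then have "Z = f {(h, l), ?\<rho> (h, l)}"
      using hk polarity_involution[OF polK] by (auto simp: f_orbit)
    with l(2) show "Z \<in> f ` orbits R ?\<rho>"
      by (auto simp: orbits_def)
  qed (use maps in blast)
  ultimately have bij: "bij_betw f (pverts ?Q) (pverts ?T)"
    by (simp add: bij_betw_def)

  have adj: "(X, Y) \<in> parcs ?Q \<longleftrightarrow> (f X, f Y) \<in> parcs ?T"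
    if X: "X \<in> orbits R ?\<rho>" and Y: "Y \<in> orbits R ?\<rho>" for X Y
  proof
    assume "(X, Y) \<in> parcs ?Q"
    then obtain a c b d where "(a, c) \<in> X" "(b, d) \<in> Y" "((a, c), (b, d)) \<in> parcs R"
      by (auto simp: parcs_polarity_quotient)
    then have "a \<in> fst ` X" "c \<in> snd ` X" "b \<in> fst ` Y" "d \<in> snd ` Y"
        "(a, b) \<in> parcs H" "(c, d) \<in> parcs K"
      by (auto simp: E intro: rev_image_eqI)
    then show "(f X, f Y) \<in> parcs ?T"
      using maps[OF X] maps[OF Y] by (auto simp: f_def parcs_polarity_quotient)
  next
    assume "(f X, f Y) \<in> parcs ?T"
    then have "\<exists>a \<in> fst (f X). \<exists>b \<in> fst (f Y). (a, b) \<in> parcs H"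
        "\<exists>c \<in> snd (f X). \<exists>d \<in> snd (f Y). (c, d) \<in> parcs K"
      by (simp_all add: f_def parcs_polarity_quotient)
    then obtain a b c d where
        ab: "a \<in> fst (f X)" "b \<in> fst (f Y)" "(a, b) \<in> parcs H" and
        cd: "c \<in> snd (f X)" "d \<in> snd (f Y)" "(c, d) \<in> parcs K"
      by blast
    have invariant: "\<rho>\<^sub>K y \<in> snd (f Z)" if "y \<in> snd (f Z)" "Z \<in> orbits R ?\<rho>" for y Z
      using that maps[OF that(2)] polarity_involution[OF polK] by (auto simp: orbits_def)
    \<comment> \<open>If \<open>(a, c)\<close> has the wrong parity, the image of the edge \<open>c d\<close> under \<open>\<rho>\<^sub>K\<close> corrects it.\<close>
    have "\<exists>c d. c \<in> snd (f X) \<and> d \<in> snd (f Y) \<and> (c, d) \<in> parcs K \<and> (a, c) \<in> pverts R"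
    proof (cases "(a, c) \<in> pverts R")
      case False
      then have "(a, \<rho>\<^sub>K c) \<in> pverts R"
        using ab cd sideK[of c] closedK[of c] H.wellformed' K.wellformed' by (auto simp: V)
      moreover have "(\<rho>\<^sub>K c, \<rho>\<^sub>K d) \<in> parcs K"
        using polK cd(3) by (rule polarity_arc[OF K.pair_wf_digraph_axioms])
      ultimately show ?thesis
        using invariant[OF cd(1) X] invariant[OF cd(2) Y] by blast
    qed (use cd in blast)
    then obtain c' d' where cd': "c' \<in> snd (f X)" "d' \<in> snd (f Y)" "(c', d') \<in> parcs K"
        "(a, c') \<in> pverts R" by blast
    moreover have "(b, d') \<in> pverts R"
      using cd' ab(3) H.wellformed' K.wellformed'
        bipartition_arc_changes_side[OF bipH ab(3)] bipartition_arc_changes_side[OF bipK cd'(3)]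
      by (auto simp: V)
    ultimately have "(a, c') \<in> X" "(b, d') \<in> Y" "((a, c'), (b, d')) \<in> parcs R"
      using ab recover[OF X] recover[OF Y] by (auto simp: E)
    with X Y show "(X, Y) \<in> parcs ?Q"
      by (auto simp: parcs_polarity_quotient)
  qed
  show ?thesis
  proof (rule digraph_iso_with_projI[OF _ _ bij])
    show "pair_wf_digraph ?Q" "pair_wf_digraph ?T"
      by (intro pair_wf_digraph_kronecker_product pair_wf_digraph_polarity_quotient)+
  qed (simp add: adj)
qed

end
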